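(* Let $R$ be an integral domain with quotient field $K$ and let $\star$ be a star operation defined on $R$. Then $A^{\star}$ is invertible for every nonzero fractional ideal $A$ of $R$ if and only if for every allowable set $\{a_\alpha\}_{\alpha\in I}\subseteq K\setminus\{0\}$ and for every nonzero ideal $A$ of $R$ we have $A^{\star}\left(\bigcap_{\alpha\in I}(a_\alpha)\right)=\bigcap_{\alpha\in I}A^{\star}a_\alpha$.
   Context: $F(R)$ denotes the set of nonzero fractional ideals of $R$, and $(a)=aR$ for $a\in K$. A star operation on $R$ is a function $A\mapsto A^{\star}$ from $F(R)$ to $F(R)$ such that for all $A,B\in F(R)$ and $a\in K\setminus\{0\}$: (i) $(a)^{\star}=(a)$ and $(aA)^{\star}=aA^{\star}$; (ii) $A\subseteq A^{\star}$, and $A\subseteq B$ implies $A^{\star}\subseteq B^{\star}$; (iii) $(A^{\star})^{\star}=A^{\star}$. A (nonempty) set $\{a_\alpha\}_{\alpha\in I}\subseteq K\setminus\{0\}$ is called allowable if $\bigcap_{\alpha\in I}(a_\alpha)\neq(0)$. *)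

theory Defs
  imports "HOL-Computational_Algebra.Polynomial_Factorial"
begin

text \<open>
  The domain R is a type \<open>'a::idom\<close>, its quotient field K is \<open>'a fract\<close>, and R is identified
  with \<open>range to_fract\<close>. R-submodules of K are the subspaces (in the sense of the locale
  \<open>module\<close>) for the scalar multiplication below.
\<close>

definition fract_scale :: "'a::idom \<Rightarrow> 'a fract \<Rightarrow> 'a fract" where
  "fract_scale r x = to_fract r * x"

interpretation fract: module fract_scale
  by unfold_locales (simp_all add: fract_scale_def algebra_simps)

definition fractional_ideal :: "'a::idom fract set \<Rightarrow> bool" where
  "fractional_ideal A \<longleftrightarrow>
     fract.subspace A \<and> (\<exists>d. d \<noteq> 0 \<and> fract_scale d ` A \<subseteq> range to_fract)"

definition nonzero_fractional_ideals :: "'a::idom fract set set" where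
  "nonzero_fractional_ideals = {A. fractional_ideal A \<and> A \<noteq> {0}}"

definition nonzero_ideals :: "'a::idom fract set set" where
  "nonzero_ideals = {A. fract.subspace A \<and> A \<subseteq> range to_fract \<and> A \<noteq> {0}}"

definition principal_ideal :: "'a::idom fract \<Rightarrow> 'a fract set" where
  "principal_ideal a = range (\<lambda>r. a * to_fract r)"

definition scale_set :: "'a::idom fract \<Rightarrow> 'a fract set \<Rightarrow> 'a fract set" where
  "scale_set a A = (\<lambda>x. a * x) ` A"

definition ideal_mult :: "'a::idom fract set \<Rightarrow> 'a fract set \<Rightarrow> 'a fract set" where
  "ideal_mult A B = fract.span {a * b | a b. a \<in> A \<and> b \<in> B}"

definition invertible_ideal :: "'a::idom fract set \<Rightarrow> bool" where
  "invertible_ideal A \<longleftrightarrow>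
     fractional_ideal A \<and> (\<exists>B. fractional_ideal B \<and> ideal_mult A B = range to_fract)"

text \<open>
  A star operation is a function from the set of nonzero fractional ideals to itself; its values
  on other sets are unconstrained.
\<close>

definition star_operation :: "('a::idom fract set \<Rightarrow> 'a fract set) \<Rightarrow> bool" where
  "star_operation star \<longleftrightarrow>
     (\<forall>A \<in> nonzero_fractional_ideals. star A \<in> nonzero_fractional_ideals) \<and>
     (\<forall>a. a \<noteq> 0 \<longrightarrow> star (principal_ideal a) = principal_ideal a) \<and>
     (\<forall>a. \<forall>A \<in> nonzero_fractional_ideals.
        a \<noteq> 0 \<longrightarrow> star (scale_set a A) = scale_set a (star A)) \<and>
     (\<forall>A \<in> nonzero_fractional_ideals. A \<subseteq> star A) \<and>
     (\<forall>A \<in> nonzero_fractional_ideals. \<forall>B \<in> nonzero_fractional_ideals.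
        A \<subseteq> B \<longrightarrow> star A \<subseteq> star B) \<and>
     (\<forall>A \<in> nonzero_fractional_ideals. star (star A) = star A)"

definition allowable :: "'a::idom fract set \<Rightarrow> bool" where
  "allowable S \<longleftrightarrow> S \<noteq> {} \<and> 0 \<notin> S \<and> (\<Inter>a\<in>S. principal_ideal a) \<noteq> {0}"

end

theory Submission
  imports Defs
begin

text \<open>
  If \<open>A\<^sup>\<star>B = R\<close>, then \<open>X = \<Inter> a\<^sub>\<alpha>A\<^sup>\<star>\<close> satisfies \<open>XB \<subseteq> \<Inter> (a\<^sub>\<alpha>)\<close>, and multiplying by \<open>A\<^sup>\<star>\<close>
  gives the inclusion of \<open>X\<close> in \<open>A\<^sup>\<star>(\<Inter> (a\<^sub>\<alpha>))\<close>. Conversely, after clearing a denominator let \<open>A\<close> be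
  integral and apply the distributivity to the inverses of the nonzero elements of \<open>A\<close>: it reads
  \<open>A\<^sup>\<star>A\<^sup>-\<^sup>1 = \<Inter> a\<^sup>-\<^sup>1A\<^sup>\<star>\<close>, whose right-hand side contains \<open>1\<close>. Since \<open>A \<subseteq> (x\<^sup>-\<^sup>1)\<close> forces
  \<open>A\<^sup>\<star> \<subseteq> (x\<^sup>-\<^sup>1)\<close> for nonzero \<open>x \<in> A\<^sup>-\<^sup>1\<close>, the product \<open>A\<^sup>\<star>A\<^sup>-\<^sup>1\<close> is \<open>R\<close>.
\<close>

section \<open>Principal ideals, scaled sets and products as submodules of \<open>K\<close>\<close>

lemma mem_principal_ideal_iff:
  fixes a :: "'a::idom fract"
  assumes "a \<noteq> 0"
  shows "x \<in> principal_ideal a \<longleftrightarrow> inverse a * x \<in> range to_fract"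
proof -
  have "x = a * y \<longleftrightarrow> inverse a * x = y" for y
    using assms by (auto simp: field_simps)
  then show ?thesis
    by (auto simp: principal_ideal_def)
qed

lemma mem_scale_set_iff:
  fixes a :: "'a::idom fract"
  assumes "a \<noteq> 0"
  shows "x \<in> scale_set a A \<longleftrightarrow> inverse a * x \<in> A"
proof -
  have "x = a * y \<longleftrightarrow> inverse a * x = y" for y
    using assms by (auto simp: field_simps)
  then show ?thesis
    by (metis image_iff scale_set_def)
qed

lemma principal_ideal_eq_scale_set: "principal_ideal a = scale_set a (range to_fract)"
  by (auto simp: principal_ideal_def scale_set_def)

lemma subspace_range_to_fract: "fract.subspace (range (to_fract :: 'a::idom \<Rightarrow> 'a fract))"
proof (rule fract.subspaceI)
  show "(0 :: 'a fract) \<in> range to_fract"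
    by (metis to_fract_0 rangeI)
  show "x + y \<in> range to_fract" if "x \<in> range to_fract" "y \<in> range to_fract"
    for x y :: "'a fract"
    using that by (auto simp flip: to_fract_add)
  show "fract_scale c x \<in> range to_fract" if "x \<in> range to_fract" for c and x :: "'a fract"
    using that by (auto simp: fract_scale_def simp flip: to_fract_mult)
qed

text \<open>Multiplication by \<open>x\<close> is linear over \<open>R\<close>, and preimages of
  submodules under linear maps are submodules.\<close>

lemma subspace_mult_vimage:
  assumes "fract.subspace A"
  shows "fract.subspace {y. x * y \<in> A}"
proof (rule fract.subspaceI)
  show "0 \<in> {y. x * y \<in> A}"
    using fract.subspace_0[OF assms] by simp
  show "y + z \<in> {y. x * y \<in> A}" if "y \<in> {y. x * y \<in> A}" "z \<in> {y. x * y \<in> A}" for y z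
    using fract.subspace_add[OF assms] that by (simp add: distrib_left)
  show "fract_scale c y \<in> {y. x * y \<in> A}" if "y \<in> {y. x * y \<in> A}" for c y
    using fract.subspace_scale[OF assms, of "x * y" c] that
    by (simp add: fract_scale_def mult.left_commute)
qed

lemma subspace_scale_set:
  assumes "fract.subspace A"
  shows "fract.subspace (scale_set a A)"
proof (cases "a = 0")
  \<comment> \<open>Since \<open>inverse 0 = 0\<close>, the preimage description used in the other
    case would give all of \<open>K\<close> here.\<close>
  case True
  then have "scale_set a A = {0}"
    using fract.subspace_0[OF assms] by (auto simp: scale_set_def)
  then show ?thesis
    by (simp add: fract.subspace_single_0)
next
  case False
  then have "scale_set a A = {x. inverse a * x \<in> A}"
    by (auto simp: mem_scale_set_iff)
  then show ?thesis
    using subspace_mult_vimage[OF assms] by simp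
qed

lemma subspace_principal_ideal: "fract.subspace (principal_ideal a)"
  unfolding principal_ideal_eq_scale_set
  by (intro subspace_scale_set subspace_range_to_fract)

lemma subspace_mult_to_fract:
  assumes "fract.subspace A" "x \<in> A" "r \<in> range to_fract"
  shows "x * r \<in> A"
  using fract.subspace_scale[OF assms(1,2)] assms(3)
  by (auto simp: fract_scale_def mult.commute)

lemma ideal_mult_subsetI:
  assumes "fract.subspace C" "\<And>a b. a \<in> A \<Longrightarrow> b \<in> B \<Longrightarrow> a * b \<in> C"
  shows "ideal_mult A B \<subseteq> C"
  unfolding ideal_mult_def using assms by (intro fract.span_minimal) auto

lemma mult_mem_ideal_mult: "a \<in> A \<Longrightarrow> b \<in> B \<Longrightarrow> a * b \<in> ideal_mult A B"
  unfolding ideal_mult_def by (intro fract.span_base) blast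

lemma subspace_ideal_mult: "fract.subspace (ideal_mult A B)"
  unfolding ideal_mult_def by (rule fract.subspace_span)

text \<open>Both products have the same generators, as the factor \<open>c\<close> can be moved from
  \<open>a\<close> to \<open>b\<close>.\<close>

lemma ideal_mult_scale_set: "ideal_mult (scale_set c A) B = ideal_mult A (scale_set c B)"
proof -
  have "{a * b | a b. a \<in> scale_set c A \<and> b \<in> B} = {a * b | a b. a \<in> A \<and> b \<in> scale_set c B}"
    unfolding scale_set_def by (auto simp: image_iff) (metis mult.assoc mult.commute)+
  then show ?thesis
    by (simp add: ideal_mult_def)
qed

section \<open>Fractional ideals and clearing of denominators\<close>

lemma fractional_ideal_scale_set_to_fract:
  assumes "fractional_ideal A"
  shows "fractional_ideal (scale_set (to_fract c) A)"
proof -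
  obtain d where d: "d \<noteq> 0" "fract_scale d ` A \<subseteq> range to_fract"
    using assms by (auto simp: fractional_ideal_def)
  \<comment> \<open>The denominator \<open>d\<close> of \<open>A\<close> also serves for
    \<open>cA\<close>, because \<open>c\<close> lies in \<open>R\<close>.\<close>
  have "fract_scale d (to_fract c * x) \<in> range to_fract" if "x \<in> A" for x
  proof -
    have "fract_scale d x \<in> range to_fract"
      using d(2) that by (rule subsetD[OF _ imageI])
    then obtain r where "to_fract d * x = to_fract r"
      unfolding fract_scale_def by (rule rangeE)
    then have "fract_scale d (to_fract c * x) = to_fract (c * r)"
      by (simp add: fract_scale_def mult.left_commute)
    then show ?thesis
      by (metis rangeI)
  qed
  then have "fract_scale d ` scale_set (to_fract c) A \<subseteq> range to_fract"
    by (auto simp: scale_set_def)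
  then show ?thesis
    using d(1) assms subspace_scale_set by (auto simp: fractional_ideal_def)
qed

text \<open>If \<open>B\<close> is an inverse of \<open>cA\<close>, then \<open>cB\<close> is an
  inverse of \<open>A\<close>. This undoes the clearing of a denominator.\<close>

lemma invertible_ideal_of_scale_set:
  assumes "fractional_ideal A" "invertible_ideal (scale_set (to_fract c) A)"
  shows "invertible_ideal A"
proof -
  obtain B where "fractional_ideal B" "ideal_mult A (scale_set (to_fract c) B) = range to_fract"
    using assms(2) by (auto simp: invertible_ideal_def ideal_mult_scale_set)
  then show ?thesis
    using assms(1) fractional_ideal_scale_set_to_fract unfolding invertible_ideal_def by blast
qed

lemma nonzero_ideals_subset: "nonzero_ideals \<subseteq> nonzero_fractional_ideals"
proof
  fix A :: "'a fract set"
  assume "A \<in> nonzero_ideals"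
  moreover from this have "fract_scale 1 ` A \<subseteq> range to_fract"
    by (auto simp: nonzero_ideals_def fract_scale_def)
  ultimately show "A \<in> nonzero_fractional_ideals"
    unfolding nonzero_ideals_def nonzero_fractional_ideals_def fractional_ideal_def
    using one_neq_zero by blast
qed

lemma principal_ideal_nonzero_fractional:
  fixes a :: "'a::idom fract"
  assumes "a \<noteq> 0"
  shows "principal_ideal a \<in> nonzero_fractional_ideals"
proof -
  obtain p q where pq: "a = Fract p q" "q \<noteq> 0"
    by (cases a)
  have "to_fract q * a = to_fract p"
    using pq by (simp add: to_fract_def eq_fract)
  then have "fract_scale q (a * to_fract r) = to_fract (p * r)" for r
    by (simp add: fract_scale_def flip: mult.assoc)
  then have "fract_scale q ` principal_ideal a \<subseteq> range to_fract"
    unfolding principal_ideal_def by blast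
  moreover have "a \<in> principal_ideal a"
    unfolding principal_ideal_def by (metis mult_1_right rangeI to_fract_1)
  ultimately show ?thesis
    using assms pq(2) subspace_principal_ideal
    by (auto simp: nonzero_fractional_ideals_def fractional_ideal_def)
qed

section \<open>The two implications for a single ideal\<close>

lemma ideal_mult_Inter_eq_if_invertible:
  fixes A :: "'a::idom fract set"
  assumes "invertible_ideal A" "0 \<notin> S"
  shows "ideal_mult A (\<Inter>a\<in>S. principal_ideal a) = (\<Inter>a\<in>S. scale_set a A)"
proof
  from assms(1) obtain B where B: "ideal_mult A B = range to_fract" and A: "fract.subspace A"
    by (auto simp: invertible_ideal_def fractional_ideal_def)
  let ?J = "\<Inter>a\<in>S. principal_ideal a"
  show "ideal_mult A ?J \<subseteq> (\<Inter>a\<in>S. scale_set a A)"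
  proof (rule INT_greatest)
    fix s assume s: "s \<in> S"
    show "ideal_mult A ?J \<subseteq> scale_set s A"
    proof (rule ideal_mult_subsetI[OF subspace_scale_set[OF A]])
      fix a b assume ab: "a \<in> A" "b \<in> ?J"
      then obtain r where r: "b = s * to_fract r"
        using s by (auto simp: principal_ideal_def)
      then have "a * b = s * (a * to_fract r)"
        by simp
      then show "a * b \<in> scale_set s A"
        using subspace_mult_to_fract[OF A ab(1) rangeI] by (auto simp: scale_set_def)
    qed
  qed
  show "(\<Inter>a\<in>S. scale_set a A) \<subseteq> ideal_mult A ?J"
  proof
    fix x assume x: "x \<in> (\<Inter>a\<in>S. scale_set a A)"
    \<comment> \<open>The right-hand side is a submodule, so products \<open>a * b\<close> suffice.
      As \<open>AB = R\<close>, taking \<open>y = 1\<close> then yields the claim for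
      \<open>x\<close>.\<close>
    have "ideal_mult A B \<subseteq> {y. x * y \<in> ideal_mult A ?J}"
    proof (rule ideal_mult_subsetI[OF subspace_mult_vimage[OF subspace_ideal_mult]])
      fix a b assume ab: "a \<in> A" "b \<in> B"
      have "x * b \<in> principal_ideal s" if s: "s \<in> S" for s
      proof -
        have "s \<noteq> 0"
          using s assms(2) by auto
        moreover from this have "inverse s * x \<in> A"
          using x s by (auto simp: mem_scale_set_iff)
        then have "inverse s * x * b \<in> range to_fract"
          using ab(2) B mult_mem_ideal_mult by blast
        ultimately show ?thesis
          by (simp add: mem_principal_ideal_iff mult.assoc)
      qed
      then have "a * (x * b) \<in> ideal_mult A ?J"
        using ab(1) by (intro mult_mem_ideal_mult) auto
      then show "a * b \<in> {y. x * y \<in> ideal_mult A ?J}"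
        by (simp add: mult.left_commute)
    qed
    moreover have "1 \<in> ideal_mult A B"
      unfolding B by (metis rangeI to_fract_1)
    ultimately show "x \<in> ideal_mult A ?J"
      by auto
  qed
qed

text \<open>The inverse of \<open>star A\<close> is the inverse ideal of \<open>A\<close> itself,
  which arises as an intersection of principal ideals.\<close>

lemma invertible_ideal_star_if_distributive:
  fixes star :: "'a::idom fract set \<Rightarrow> 'a fract set"
  assumes star: "star_operation star"
    and A: "A \<in> nonzero_ideals"
    and distributive: "\<And>S. allowable S \<Longrightarrow>
      ideal_mult (star A) (\<Inter>a\<in>S. principal_ideal a) = (\<Inter>a\<in>S. scale_set a (star A))"
  shows "invertible_ideal (star A)"
proof -
  define S where "S = inverse ` (A - {0})"
  define J where "J = (\<Inter>a\<in>S. principal_ideal a)"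
  have A_frac: "A \<in> nonzero_fractional_ideals"
    using A nonzero_ideals_subset by blast
  have sA: "fractional_ideal (star A)" "A \<subseteq> star A"
    using star A_frac by (auto simp: star_operation_def nonzero_fractional_ideals_def)
  have A_sub: "A \<subseteq> range to_fract" and "fract.subspace A" "A \<noteq> {0}"
    using A by (auto simp: nonzero_ideals_def)
  moreover from this have "0 \<in> A"
    using fract.subspace_0 by blast
  ultimately obtain x where "x \<in> A" "x \<noteq> 0"
    by blast
  \<comment> \<open>This element makes \<open>S\<close> nonempty and later serves as a denominator
    of \<open>J\<close>.\<close>
  with A_sub obtain r where r: "to_fract r \<in> A" "r \<noteq> 0"
    by auto
  have S: "S \<noteq> {}" "0 \<notin> S"
    using r by (auto simp: S_def)
  \<comment> \<open>Thus \<open>J\<close> is the inverse ideal of \<open>A\<close>; the element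
    \<open>0\<close>, left out of \<open>S\<close>, imposes no condition.\<close>
  have J_iff: "x \<in> J \<longleftrightarrow> (\<forall>a\<in>A. a * x \<in> range to_fract)" for x
  proof -
    have "0 * x \<in> range to_fract"
      by (metis mult_zero_left rangeI to_fract_0)
    then show ?thesis
      by (auto simp: J_def S_def mem_principal_ideal_iff)
  qed
  have "1 \<in> J"
    using A_sub by (auto simp: J_iff)
  then have "J \<noteq> {0}"
    by auto
  then have "allowable S"
    using S by (simp add: allowable_def J_def)
  then have eq: "ideal_mult (star A) J = (\<Inter>a\<in>S. scale_set a (star A))"
    unfolding J_def by (rule distributive)
  have "fract.subspace J"
    unfolding J_def by (intro fract.subspace_Inter) (auto intro: subspace_principal_ideal)
  moreover have "fract_scale r ` J \<subseteq> range to_fract"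
    using r(1) by (auto simp: J_iff fract_scale_def)
  ultimately have "fractional_ideal J"
    using r(2) by (auto simp: fractional_ideal_def)
  moreover have "ideal_mult (star A) J = range to_fract"
  proof
    show "ideal_mult (star A) J \<subseteq> range to_fract"
    proof (rule ideal_mult_subsetI[OF subspace_range_to_fract])
      fix a x assume a: "a \<in> star A" and x: "x \<in> J"
      show "a * x \<in> range to_fract"
      proof (cases "x = 0")
        case True
        then show ?thesis
          by (metis mult_zero_right rangeI to_fract_0)
      next
        case False
        \<comment> \<open>The condition \<open>xA \<subseteq> R\<close> is rewritten as containment
          in a principal ideal, which \<open>star\<close> fixes, so that it passes to
          \<open>star A\<close> by monotonicity.\<close>
        then have "A \<subseteq> principal_ideal (inverse x)"
          using x by (auto simp: J_iff mem_principal_ideal_iff mult.commute)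
        moreover have "principal_ideal (inverse x) \<in> nonzero_fractional_ideals"
          using False by (simp add: principal_ideal_nonzero_fractional)
        ultimately have "star A \<subseteq> star (principal_ideal (inverse x))"
          using star A_frac unfolding star_operation_def by blast
        also have "\<dots> = principal_ideal (inverse x)"
          using star False by (simp add: star_operation_def)
        finally show ?thesis
          using a False by (auto simp: mem_principal_ideal_iff mult.commute)
      qed
    qed
    \<comment> \<open>By \<open>eq\<close> it suffices that each nonzero \<open>a\<close> in
      \<open>A\<close> lies in \<open>star A\<close>.\<close>
    have "1 \<in> ideal_mult (star A) J"
      using sA(2) by (auto simp: eq S_def mem_scale_set_iff)
    then show "range to_fract \<subseteq> ideal_mult (star A) J"
      using subspace_mult_to_fract[OF subspace_ideal_mult] by fastforce
  qed
  ultimately show ?thesis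
    using sA(1) by (auto simp: invertible_ideal_def)
qed

theorem theorem2p2:
  fixes star :: "'a::idom fract set \<Rightarrow> 'a fract set"
  assumes "star_operation star"
  shows "(\<forall>A \<in> nonzero_fractional_ideals. invertible_ideal (star A)) \<longleftrightarrow>
    (\<forall>S :: 'a fract set. allowable S \<longrightarrow>
      (\<forall>A \<in> nonzero_ideals.
        ideal_mult (star A) (\<Inter>a\<in>S. principal_ideal a) = (\<Inter>a\<in>S. scale_set a (star A))))"
    (is "?inv \<longleftrightarrow> ?dist")
proof
  assume inv: ?inv
  show ?dist
  proof (intro allI impI ballI)
    fix S A :: "'a fract set"
    assume "allowable S" "A \<in> nonzero_ideals"
    then have "0 \<notin> S" "invertible_ideal (star A)"
      using inv nonzero_ideals_subset by (auto simp: allowable_def)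
    then show "ideal_mult (star A) (\<Inter>a\<in>S. principal_ideal a) = (\<Inter>a\<in>S. scale_set a (star A))"
      by (intro ideal_mult_Inter_eq_if_invertible)
  qed
next
  assume dist: ?dist
  show ?inv
  proof
    fix A :: "'a fract set"
    assume A: "A \<in> nonzero_fractional_ideals"
    then obtain d where d: "d \<noteq> 0" "fract_scale d ` A \<subseteq> range to_fract"
      by (auto simp: nonzero_fractional_ideals_def fractional_ideal_def)
    \<comment> \<open>The distributivity concerns integral ideals only, so it is applied to
      \<open>dA\<close>.\<close>
    let ?A' = "scale_set (to_fract d) A"
    have "?A' \<noteq> {0}"
    proof
      assume A': "?A' = {0}"
      then have "A \<noteq> {}"
        by (auto simp: scale_set_def)
      moreover have "x = 0" if "x \<in> A" for x
        using A' that d(1) unfolding scale_set_def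
        by (metis imageI mult_eq_0_iff singletonD to_fract_eq_0_iff)
      ultimately show False
        using A by (auto simp: nonzero_fractional_ideals_def)
    qed
    moreover have "fract.subspace ?A'"
      using A by (intro subspace_scale_set)
        (auto simp: nonzero_fractional_ideals_def fractional_ideal_def)
    moreover have "?A' \<subseteq> range to_fract"
      using d(2) by (auto simp: scale_set_def fract_scale_def)
    ultimately have "?A' \<in> nonzero_ideals"
      by (simp add: nonzero_ideals_def)
    then have "invertible_ideal (star ?A')"
      using dist by (intro invertible_ideal_star_if_distributive[OF assms]) simp_all
    \<comment> \<open>As \<open>star\<close> commutes with scaling by \<open>d\<close>,
      invertibility can be carried back from \<open>dA\<close> to \<open>A\<close>.\<close>
    also have "star ?A' = scale_set (to_fract d) (star A)"
      using assms A d(1) by (simp add: star_operation_def)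
    finally have "invertible_ideal (scale_set (to_fract d) (star A))" .
    moreover have "star A \<in> nonzero_fractional_ideals"
      using assms A by (simp add: star_operation_def)
    ultimately show "invertible_ideal (star A)"
      by (auto simp: nonzero_fractional_ideals_def intro: invertible_ideal_of_scale_set)
  qed
qed

end
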